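(* Let $\Lambda,\omega,\kappa,\alpha_1,\alpha_2,\gamma,\delta,\rho$ be strictly positive real constants and let $V\ge 0$ be a real constant, such that $(\alpha_1-\rho)\gamma+(\alpha_2+\delta)\kappa V+\alpha_1(\alpha_2+\delta)\neq 0$. Consider the system of ordinary differential equations $$ \begin{cases} \dfrac{dU(t)}{dt}=\Lambda-\kappa U(t)V-\alpha_1U(t)+\gamma E(t),\\[0.3cm] \dfrac{dE(t)}{dt}=\omega+\kappa U(t)V-\alpha_2E(t)-\gamma E(t)-\delta E(t)+\rho U(t), \end{cases} $$ and its equilibrium point $E_b=(U^{*},E^{*})$ given by $$ U^{*}=\frac{\Lambda(\delta+\alpha_2)+(\omega+\Lambda)\gamma}{(\alpha_1-\rho)\gamma+(\alpha_2+\delta)\kappa V+\alpha_1(\alpha_2+\delta)},\qquad E^{*}=\frac{\alpha_1\omega+\Lambda\rho+\kappa(\omega+\Lambda)V}{(\alpha_1-\rho)\gamma+(\alpha_2+\delta)\kappa V+\alpha_1(\alpha_2+\delta)}. $$ Then $E_b$ is locally asymptotically stable if and only if $$ V\alpha_2\kappa+V\delta\kappa+\alpha_1\alpha_2+\alpha_1\delta+\alpha_1\gamma>\gamma\rho . $$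
   Context: The system models unemployment: $U(t)$ and $E(t)$ are the numbers of unemployed and employed individuals at time $t$, and $V$ is the (exogenous) number of vacancies, treated as a constant in the equilibrium and stability analysis. Local asymptotic stability is meant in the usual sense of Lyapunov for an equilibrium of an autonomous system of ordinary differential equations in $\mathbb{R}^2$. *)

theory Defs
  imports "HOL-Analysis.Analysis"
begin

definition ode_solution :: "('a::real_normed_vector \<Rightarrow> 'a) \<Rightarrow> 'a \<Rightarrow> (real \<Rightarrow> 'a) \<Rightarrow> bool" where
  "ode_solution f x0 x \<longleftrightarrow>
     x 0 = x0 \<and> (\<forall>t\<ge>0. (x has_vector_derivative f (x t)) (at t within {0..}))"

definition equilibrium :: "('a::real_normed_vector \<Rightarrow> 'a) \<Rightarrow> 'a \<Rightarrow> bool" where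
  "equilibrium f p \<longleftrightarrow> f p = 0"

text \<open>
  In the next two definitions, solutions on the half-line are required to exist for all initial
  values near the point, so that the statement about all such solutions is never vacuous.
  Uniqueness of solutions is not required.
\<close>

definition lyapunov_stable :: "('a::real_normed_vector \<Rightarrow> 'a) \<Rightarrow> 'a \<Rightarrow> bool" where
  "lyapunov_stable f p \<longleftrightarrow>
     (\<forall>\<epsilon>>0. \<exists>d>0. \<forall>x0. dist x0 p < d \<longrightarrow>
        (\<exists>x. ode_solution f x0 x) \<and>
        (\<forall>x. ode_solution f x0 x \<longrightarrow> (\<forall>t\<ge>0. dist (x t) p < \<epsilon>)))"

definition locally_attractive :: "('a::real_normed_vector \<Rightarrow> 'a) \<Rightarrow> 'a \<Rightarrow> bool" where
  "locally_attractive f p \<longleftrightarrow>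
     (\<exists>d>0. \<forall>x0. dist x0 p < d \<longrightarrow>
        (\<exists>x. ode_solution f x0 x) \<and>
        (\<forall>x. ode_solution f x0 x \<longrightarrow> (x \<longlongrightarrow> p) at_top))"

definition locally_asymptotically_stable ::
    "('a::real_normed_vector \<Rightarrow> 'a) \<Rightarrow> 'a \<Rightarrow> bool" where
  "locally_asymptotically_stable f p \<longleftrightarrow>
     equilibrium f p \<and> lyapunov_stable f p \<and> locally_attractive f p"

text \<open>A state is a pair of the numbers of unemployed and of employed individuals.\<close>

definition unemployment_field ::
    "real \<Rightarrow> real \<Rightarrow> real \<Rightarrow> real \<Rightarrow> real \<Rightarrow> real \<Rightarrow> real \<Rightarrow> real \<Rightarrow> real
      \<Rightarrow> real \<times> real \<Rightarrow> real \<times> real" where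
  "unemployment_field \<Lambda> \<omega> \<kappa> \<alpha>1 \<alpha>2 \<gamma> \<delta> \<rho> V = (\<lambda>(U, E).
     (\<Lambda> - \<kappa> * U * V - \<alpha>1 * U + \<gamma> * E,
      \<omega> + \<kappa> * U * V - \<alpha>2 * E - \<gamma> * E - \<delta> * E + \<rho> * U))"

end

theory Submission
  imports Defs
begin

text \<open>
  Measured from the equilibrium, the system is \<open>u' = - a * u + \<gamma> * e\<close>,
  \<open>e' = b * u - d * e\<close>, where \<open>a = \<kappa> * V + \<alpha>1\<close>, \<open>b = \<kappa> * V + \<rho>\<close> and
  \<open>d = \<alpha>2 + \<gamma> + \<delta>\<close> are positive. Let \<open>A\<close> be its coefficient matrix.
  Its off-diagonal entries are positive, so the discriminant \<open>(a - d)\<^sup>2 + 4 * \<gamma> * b\<close> of the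
  characteristic polynomial is positive and \<open>A\<close> has two distinct real eigenvalues \<open>l < r\<close>.
  The trace \<open>l + r = -(a + d)\<close> is negative, and the determinant \<open>l * r = a * d - \<gamma> * b\<close> is
  the common denominator of \<open>Us\<close> and \<open>Es\<close>, that is, the difference of the two sides of the stability criterion.
  A positive determinant makes both eigenvalues negative; a negative one makes \<open>r\<close> positive.
  A zero eigenvalue is excluded by hypothesis.

  A diagonalizable linear system decouples: the component of a solution in each
  eigenspace satisfies a scalar equation \<open>y' = \<mu> y\<close> and hence is an exponential
  (\<open>spectral_component_solution\<close>). If all eigenvalues are negative, every solution decays to the
  equilibrium and is controlled by its initial value (\<open>stable_if_negative_spectrum\<close>); if one is
  positive, a solution that starts with a nonzero component in its eigenspace cannot converge to
  the equilibrium (\<open>not_attractive_if_positive_eigenvalue\<close>). The spectral projections of \<open>A\<close>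
  are obtained without eigenvectors, from the quadratic equation that \<open>A\<close> satisfies by the
  theorem of Cayley and Hamilton (\<open>diagonalized_if_quadratic\<close>).
\<close>

section \<open>Linear differential equations with a diagonalizable operator\<close>

text \<open>
  The integrating factor \<open>exp (- c * t)\<close> turns the solution into a constant, which also shows
  that solutions are unique.
\<close>

lemma linear_growth_solution:
  fixes y :: "real \<Rightarrow> 'a::real_normed_vector"
  assumes deriv: "\<And>t. t \<ge> 0 \<Longrightarrow> (y has_vector_derivative c *\<^sub>R y t) (at t within {0..})"
    and "t \<ge> 0"
  shows "y t = exp (c * t) *\<^sub>R y 0"
proof -
  have "((\<lambda>t. exp (- c * t) *\<^sub>R y t) has_vector_derivative 0) (at s within {0..})"
    if "s \<in> {0..}" for s
  proof -
    have "((\<lambda>t. exp (- c * t)) has_field_derivative - c * exp (- c * s)) (at s within {0..})"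
      by (auto intro!: derivative_eq_intros)
    from has_vector_derivative_scaleR[OF this deriv[of s]] that show ?thesis
      by (simp add: algebra_simps)
  qed
  then obtain k where k: "\<And>s. s \<in> {0..} \<Longrightarrow> exp (- c * s) *\<^sub>R y s = k"
    using has_vector_derivative_zero_constant[of "{0..}" "\<lambda>t. exp (- c * t) *\<^sub>R y t"] by auto
  have "exp (- c * t) *\<^sub>R y t = y 0"
    using k[of t] k[of 0] \<open>t \<ge> 0\<close> by simp
  then have "exp (c * t) *\<^sub>R y 0 = (exp (c * t) * exp (- c * t)) *\<^sub>R y t"
    by (metis scaleR_scaleR)
  then show ?thesis
    by (simp flip: exp_add)
qed

text \<open>
  An operator \<open>A\<close> together with a decomposition of the space into finitely many eigenspaces. The
  decomposition is given by its spectral projections, indexed by the eigenvalues.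
\<close>

locale diagonalized_operator =
  fixes A :: "'a::real_normed_vector \<Rightarrow> 'a" and S :: "real set" and P :: "real \<Rightarrow> 'a \<Rightarrow> 'a"
  assumes finite_spectrum: "finite S"
    and bounded_linear_op: "bounded_linear A"
    and bounded_linear_projection: "\<mu> \<in> S \<Longrightarrow> bounded_linear (P \<mu>)"
    and projection_op: "\<mu> \<in> S \<Longrightarrow> P \<mu> (A v) = \<mu> *\<^sub>R P \<mu> v"
    and op_projection: "\<mu> \<in> S \<Longrightarrow> A (P \<mu> v) = \<mu> *\<^sub>R P \<mu> v"
    and sum_projections: "(\<Sum>\<mu>\<in>S. P \<mu> v) = v"
begin

abbreviation field_about :: "'a \<Rightarrow> 'a \<Rightarrow> 'a" where
  "field_about p x \<equiv> A (x - p)"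

text \<open>
  The projection \<open>P \<mu>\<close> commutes with differentiation, being bounded and linear, and it turns the
  operator into multiplication by \<open>\<mu>\<close>. So it maps a solution to a solution of \<open>y' = \<mu> y\<close>.
\<close>

lemma spectral_component_solution:
  assumes sol: "ode_solution (field_about p) x0 x" and "\<mu> \<in> S" and "t \<ge> 0"
  shows "P \<mu> (x t - p) = exp (\<mu> * t) *\<^sub>R P \<mu> (x0 - p)"
proof -
  have "((\<lambda>t. P \<mu> (x t - p)) has_vector_derivative \<mu> *\<^sub>R P \<mu> (x s - p)) (at s within {0..})"
    if "s \<ge> 0" for s
  proof -
    have "(x has_vector_derivative A (x s - p)) (at s within {0..})"
      using sol that by (simp add: ode_solution_def)
    then have "((\<lambda>t. x t - p) has_vector_derivative A (x s - p)) (at s within {0..})"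
      by (auto intro!: derivative_eq_intros)
    from bounded_linear.has_vector_derivative[OF bounded_linear_projection[OF \<open>\<mu> \<in> S\<close>] this]
    show ?thesis
      by (simp add: projection_op[OF \<open>\<mu> \<in> S\<close>])
  qed
  from linear_growth_solution[OF this \<open>t \<ge> 0\<close>] show ?thesis
    using sol by (simp add: ode_solution_def)
qed

lemma solution_eq:
  assumes "ode_solution (field_about p) x0 x" and "t \<ge> 0"
  shows "x t - p = (\<Sum>\<mu>\<in>S. exp (\<mu> * t) *\<^sub>R P \<mu> (x0 - p))"
  using spectral_component_solution[OF assms(1) _ assms(2)] sum_projections[of "x t - p"]
  by (metis (no_types, lifting) sum.cong)

lemma solution_exists: "\<exists>x. ode_solution (field_about p) x0 x"
proof
  let ?v = "x0 - p"
  let ?x = "\<lambda>t. p + (\<Sum>\<mu>\<in>S. exp (\<mu> * t) *\<^sub>R P \<mu> ?v)"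
  have "(?x has_vector_derivative A (?x t - p)) (at t within {0..})" for t
  proof -
    interpret A: bounded_linear A by (rule bounded_linear_op)
    have field: "A (?x t - p) = (\<Sum>\<mu>\<in>S. (\<mu> * exp (\<mu> * t)) *\<^sub>R P \<mu> ?v)"
      by (auto simp: A.sum A.scaleR op_projection mult.commute intro!: sum.cong)
    have "((\<lambda>t. exp (\<mu> * t) *\<^sub>R P \<mu> ?v) has_vector_derivative
        (\<mu> * exp (\<mu> * t)) *\<^sub>R P \<mu> ?v) (at t within {0..})" for \<mu>
    proof -
      have "((\<lambda>t. exp (\<mu> * t)) has_field_derivative \<mu> * exp (\<mu> * t)) (at t within {0..})"
        by (auto intro!: derivative_eq_intros)
      from has_vector_derivative_scaleR[OF this has_vector_derivative_const[of "P \<mu> ?v"]]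
      show ?thesis by simp
    qed
    then have "((\<lambda>t. \<Sum>\<mu>\<in>S. exp (\<mu> * t) *\<^sub>R P \<mu> ?v) has_vector_derivative
        (\<Sum>\<mu>\<in>S. (\<mu> * exp (\<mu> * t)) *\<^sub>R P \<mu> ?v)) (at t within {0..})"
      by (intro has_vector_derivative_sum)
    from has_vector_derivative_add[OF has_vector_derivative_const[of p] this]
    show ?thesis unfolding field by simp
  qed
  then show "ode_solution (field_about p) x0 ?x"
    by (simp add: ode_solution_def sum_projections)
qed

text \<open>
  With no positive exponent, no spectral component grows, so the distance to \<open>p\<close> is at most the
  initial distance times the constant \<open>\<Sum>\<mu>\<in>S. onorm (P \<mu>)\<close>.
\<close>

lemma stable_if_nonpositive_spectrum:
  assumes nonpos: "\<And>\<mu>. \<mu> \<in> S \<Longrightarrow> \<mu> \<le> 0"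
  shows "lyapunov_stable (field_about p) p"
  unfolding lyapunov_stable_def
proof (intro allI impI)
  fix \<epsilon> :: real assume "\<epsilon> > 0"
  define K where "K = (\<Sum>\<mu>\<in>S. onorm (P \<mu>))"
  have "K \<ge> 0"
    unfolding K_def by (intro sum_nonneg onorm_pos_le bounded_linear_projection)
  have bound: "dist (x t) p \<le> K * dist x0 p"
    if "ode_solution (field_about p) x0 x" and "t \<ge> 0" for x0 x t
  proof -
    have "dist (x t) p = norm (\<Sum>\<mu>\<in>S. exp (\<mu> * t) *\<^sub>R P \<mu> (x0 - p))"
      using solution_eq[OF that] by (simp add: dist_norm)
    also have "\<dots> \<le> (\<Sum>\<mu>\<in>S. onorm (P \<mu>) * norm (x0 - p))"
    proof (rule sum_norm_le)
      fix \<mu> assume "\<mu> \<in> S"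
      have "exp (\<mu> * t) \<le> 1"
        using nonpos[OF \<open>\<mu> \<in> S\<close>] \<open>t \<ge> 0\<close> by (simp add: mult_nonpos_nonneg)
      then have "norm (exp (\<mu> * t) *\<^sub>R P \<mu> (x0 - p)) \<le> norm (P \<mu> (x0 - p))"
        by (simp add: mult_left_le_one_le)
      also have "\<dots> \<le> onorm (P \<mu>) * norm (x0 - p)"
        by (rule onorm[OF bounded_linear_projection[OF \<open>\<mu> \<in> S\<close>]])
      finally show "norm (exp (\<mu> * t) *\<^sub>R P \<mu> (x0 - p)) \<le> onorm (P \<mu>) * norm (x0 - p)" .
    qed
    finally show ?thesis
      by (simp add: K_def sum_distrib_right dist_norm)
  qed
  \<comment> \<open>The summand 1 keeps the radius positive when the factor vanishes, as on the zero space.\<close>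
  have "\<epsilon> / (K + 1) > 0"
    using \<open>\<epsilon> > 0\<close> \<open>K \<ge> 0\<close> by simp
  moreover have "dist (x t) p < \<epsilon>"
    if "dist x0 p < \<epsilon> / (K + 1)" and "ode_solution (field_about p) x0 x" and "t \<ge> 0" for x0 x t
  proof -
    have "dist (x t) p \<le> (K + 1) * dist x0 p"
      using bound[OF that(2,3)] by (simp add: distrib_right add_increasing2)
    also have "\<dots> < \<epsilon>"
      using that(1) \<open>K \<ge> 0\<close> by (simp add: field_simps)
    finally show ?thesis .
  qed
  ultimately show "\<exists>d>0. \<forall>x0. dist x0 p < d \<longrightarrow>
      (\<exists>x. ode_solution (field_about p) x0 x) \<and>
      (\<forall>x. ode_solution (field_about p) x0 x \<longrightarrow> (\<forall>t\<ge>0. dist (x t) p < \<epsilon>))"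
    using solution_exists by blast
qed

lemma solution_tendsto_if_negative_spectrum:
  assumes neg: "\<And>\<mu>. \<mu> \<in> S \<Longrightarrow> \<mu> < 0" and sol: "ode_solution (field_about p) x0 x"
  shows "(x \<longlongrightarrow> p) at_top"
proof -
  have "((\<lambda>t. \<Sum>\<mu>\<in>S. exp (\<mu> * t) *\<^sub>R P \<mu> (x0 - p)) \<longlongrightarrow> (\<Sum>\<mu>\<in>S. 0 *\<^sub>R P \<mu> (x0 - p))) at_top"
  proof (intro tendsto_sum tendsto_scaleR tendsto_const)
    fix \<mu> assume "\<mu> \<in> S"
    then have "filterlim (\<lambda>t. \<mu> * t) at_bot at_top"
      using neg filterlim_tendsto_neg_mult_at_bot[OF tendsto_const _ filterlim_ident] by blast
    then show "((\<lambda>t. exp (\<mu> * t)) \<longlongrightarrow> 0) at_top"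
      by (rule filterlim_compose[OF exp_at_bot])
  qed
  moreover have "\<forall>\<^sub>F t in at_top. (\<Sum>\<mu>\<in>S. exp (\<mu> * t) *\<^sub>R P \<mu> (x0 - p)) = x t - p"
    using eventually_ge_at_top[of 0] by eventually_elim (simp add: solution_eq[OF sol])
  ultimately have "((\<lambda>t. x t - p) \<longlongrightarrow> 0) at_top"
    by (simp add: tendsto_cong)
  then show ?thesis
    by (simp add: LIM_zero_iff)
qed

lemma stable_if_negative_spectrum:
  assumes neg: "\<And>\<mu>. \<mu> \<in> S \<Longrightarrow> \<mu> < 0"
  shows "locally_asymptotically_stable (field_about p) p"
proof -
  have "equilibrium (field_about p) p"
    by (simp add: equilibrium_def bounded_linear.linear[OF bounded_linear_op] linear_0)
  moreover have "lyapunov_stable (field_about p) p"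
    using neg by (intro stable_if_nonpositive_spectrum) (simp add: less_imp_le)
  moreover have "locally_attractive (field_about p) p"
    unfolding locally_attractive_def
    using solution_exists solution_tendsto_if_negative_spectrum[OF neg]
    by (intro exI[of _ 1]) auto
  ultimately show ?thesis
    by (simp add: locally_asymptotically_stable_def)
qed

text \<open>
  The component of a solution in an eigenspace with positive eigenvalue does not shrink, so it
  tends to zero only if it is zero initially. Arbitrarily close to \<open>p\<close> there are initial values
  for which it is not.
\<close>

lemma not_attractive_if_positive_eigenvalue:
  assumes "\<mu> \<in> S" and "\<mu> > 0" and "P \<mu> v \<noteq> 0"
  shows "\<not> locally_attractive (field_about p) p"
proof
  assume "locally_attractive (field_about p) p"
  then obtain d where "d > 0" and attr: "\<And>x0 x. dist x0 p < d \<Longrightarrow>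
      ode_solution (field_about p) x0 x \<Longrightarrow> (x \<longlongrightarrow> p) at_top"
    unfolding locally_attractive_def by blast
  interpret P: bounded_linear "P \<mu>"
    by (rule bounded_linear_projection[OF \<open>\<mu> \<in> S\<close>])
  have "v \<noteq> 0"
    using \<open>P \<mu> v \<noteq> 0\<close> P.zero by auto
  define c where "c = d / (2 * norm v)"
  define x0 where "x0 = p + c *\<^sub>R v"
  have "c > 0"
    using \<open>d > 0\<close> \<open>v \<noteq> 0\<close> by (simp add: c_def)
  have "dist x0 p < d"
    using \<open>d > 0\<close> \<open>v \<noteq> 0\<close> by (simp add: x0_def c_def dist_norm)
  obtain x where sol: "ode_solution (field_about p) x0 x"
    using solution_exists by blast
  have "((\<lambda>t. x t - p) \<longlongrightarrow> 0) at_top"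
    using attr[OF \<open>dist x0 p < d\<close> sol] by (simp add: LIM_zero)
  from P.tendsto_zero[OF this] have lim: "((\<lambda>t. norm (P \<mu> (x t - p))) \<longlongrightarrow> 0) at_top"
    by (rule tendsto_norm_zero)
  have "norm (P \<mu> (c *\<^sub>R v)) \<le> norm (P \<mu> (x t - p))" if "t \<ge> 0" for t
  proof -
    have "P \<mu> (x t - p) = exp (\<mu> * t) *\<^sub>R P \<mu> (c *\<^sub>R v)"
      using spectral_component_solution[OF sol \<open>\<mu> \<in> S\<close> that] by (simp add: x0_def)
    moreover have "1 \<le> exp (\<mu> * t)"
      using \<open>\<mu> > 0\<close> that by simp
    ultimately show ?thesis
      using mult_right_mono[of 1 "exp (\<mu> * t)" "norm (P \<mu> (c *\<^sub>R v))"] by simp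
  qed
  then have "\<forall>\<^sub>F t in at_top. norm (P \<mu> (c *\<^sub>R v)) \<le> norm (P \<mu> (x t - p))"
    using eventually_ge_at_top[of 0] by (rule eventually_mono[rotated])
  from tendsto_lowerbound[OF lim this] have "P \<mu> (c *\<^sub>R v) = 0"
    by simp
  then show False
    using \<open>c > 0\<close> \<open>P \<mu> v \<noteq> 0\<close> by (simp add: P.scaleR)
qed

end

section \<open>Spectral projections from a quadratic equation\<close>

text \<open>
  If \<open>(A - l) (A - r) = 0\<close> with distinct \<open>l\<close> and \<open>r\<close>, then \<open>(A - r) / (l - r)\<close> and
  \<open>(A - l) / (r - l)\<close> are the projections onto the kernels of \<open>A - l\<close> and \<open>A - r\<close>. Since the
  other root is \<open>l + r - \<mu>\<close>, one formula in \<open>\<mu>\<close> covers both.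
\<close>

definition quadratic_projection ::
    "('a::real_normed_vector \<Rightarrow> 'a) \<Rightarrow> real \<Rightarrow> real \<Rightarrow> real \<Rightarrow> 'a \<Rightarrow> 'a" where
  "quadratic_projection A l r \<mu> v = (1 / (2 * \<mu> - (l + r))) *\<^sub>R (A v - (l + r - \<mu>) *\<^sub>R v)"

lemma diagonalized_if_quadratic:
  assumes A: "bounded_linear A"
    and quadratic: "\<And>v. A (A v) = (l + r) *\<^sub>R A v - (l * r) *\<^sub>R v"
    and "l \<noteq> r"
  shows "diagonalized_operator A {l, r} (quadratic_projection A l r)"
proof (rule diagonalized_operator.intro)
  interpret A: bounded_linear A by (rule A)
  show "finite {l, r}" by simp
  show "bounded_linear A" by (rule A)
  show "bounded_linear (quadratic_projection A l r \<mu>)" for \<mu>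
    unfolding quadratic_projection_def
    by (intro bounded_linear_compose[OF bounded_linear_scaleR_right] bounded_linear_sub A
        bounded_linear_scaleR_right)
  have eigen: "A (A v) - (l + r - \<mu>) *\<^sub>R A v = \<mu> *\<^sub>R (A v - (l + r - \<mu>) *\<^sub>R v)"
    if "\<mu> \<in> {l, r}" for \<mu> v
    using that by (auto simp: quadratic algebra_simps)
  show "quadratic_projection A l r \<mu> (A v) = \<mu> *\<^sub>R quadratic_projection A l r \<mu> v"
    if "\<mu> \<in> {l, r}" for \<mu> v
    unfolding quadratic_projection_def eigen[OF that] by (simp add: mult.commute)
  then show "A (quadratic_projection A l r \<mu> v) = \<mu> *\<^sub>R quadratic_projection A l r \<mu> v"
    if "\<mu> \<in> {l, r}" for \<mu> v
    using that by (metis A.diff A.scaleR quadratic_projection_def)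
  show "(\<Sum>\<mu>\<in>{l, r}. quadratic_projection A l r \<mu> v) = v" for v
  proof -
    have coeffs: "1 / (2 * l - (l + r)) = - (1 / (r - l))" "2 * r - (l + r) = r - l"
        "l + r - l = r" "l + r - r = l"
      using \<open>l \<noteq> r\<close> by (simp_all add: divide_simps)
    have "(\<Sum>\<mu>\<in>{l, r}. quadratic_projection A l r \<mu> v) =
        quadratic_projection A l r l v + quadratic_projection A l r r v"
      using \<open>l \<noteq> r\<close> by simp
    also have "\<dots> = - (1 / (r - l)) *\<^sub>R (A v - r *\<^sub>R v) + (1 / (r - l)) *\<^sub>R (A v - l *\<^sub>R v)"
      by (simp only: quadratic_projection_def coeffs)
    also have "\<dots> = (1 / (r - l)) *\<^sub>R ((A v - l *\<^sub>R v) - (A v - r *\<^sub>R v))"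
      by (simp only: scaleR_diff_right scaleR_minus_left) simp
    also have "\<dots> = (1 / (r - l)) *\<^sub>R ((r - l) *\<^sub>R v)"
      by (simp add: scaleR_diff_left)
    also have "\<dots> = v"
      using \<open>l \<noteq> r\<close> by simp
    finally show ?thesis .
  qed
qed

section \<open>Planar systems and the unemployment model\<close>

lemma distinct_real_roots_if_discriminant_pos:
  fixes \<tau> \<Delta> :: real
  assumes "\<tau>\<^sup>2 - 4 * \<Delta> > 0"
  obtains l r where "l < r" and "l + r = \<tau>" and "l * r = \<Delta>"
proof
  let ?s = "sqrt (\<tau>\<^sup>2 - 4 * \<Delta>)"
  show "(\<tau> - ?s) / 2 < (\<tau> + ?s) / 2"
    using assms by simp
  show "(\<tau> - ?s) / 2 + (\<tau> + ?s) / 2 = \<tau>"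
    by (simp add: field_simps)
  have "(\<tau> - ?s) / 2 * ((\<tau> + ?s) / 2) = (\<tau>\<^sup>2 - ?s\<^sup>2) / 4"
    by (simp add: algebra_simps power2_eq_square)
  then show "(\<tau> - ?s) / 2 * ((\<tau> + ?s) / 2) = \<Delta>"
    using assms by simp
qed

text \<open>
  Positive off-diagonal entries, which make the system cooperative, rule out complex and double
  eigenvalues. So there are always two spectral projections, and stability is decided by the signs
  of the eigenvalues: their sum is negative, hence both are negative exactly if their product is
  positive.
\<close>

lemma planar_cooperative_stable_iff:
  fixes a b c d :: real and p :: "real \<times> real"
  assumes "b > 0" and "c > 0" and "a + d > 0" and "a * d - c * b \<noteq> 0"
  defines "A \<equiv> \<lambda>(u, e). (- a * u + c * e, b * u - d * e)"
  shows "locally_asymptotically_stable (\<lambda>x. A (x - p)) p \<longleftrightarrow> a * d - c * b > 0"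
proof -
  have "(- (a + d))\<^sup>2 - 4 * (a * d - c * b) = (a - d)\<^sup>2 + 4 * (c * b)"
    by (simp add: power2_eq_square algebra_simps)
  moreover have "c * b > 0"
    using assms by simp
  ultimately have "(- (a + d))\<^sup>2 - 4 * (a * d - c * b) > 0"
    by (smt (verit) zero_le_power2)
  then obtain l r where "l < r" and trace: "l + r = - (a + d)" and det: "l * r = a * d - c * b"
    using distinct_real_roots_if_discriminant_pos by metis
  have "A = (\<lambda>v. (- a * fst v + c * snd v, b * fst v - d * snd v))"
    by (auto simp: A_def split: prod.splits)
  moreover have "bounded_linear (\<lambda>v::real \<times> real. (- a * fst v + c * snd v, b * fst v - d * snd v))"
    by (intro bounded_linear_Pair bounded_linear_add bounded_linear_sub
        bounded_linear_compose[OF bounded_linear_mult_right] bounded_linear_fst bounded_linear_snd)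
  ultimately have "bounded_linear A"
    by simp
  moreover have "A (A v) = (l + r) *\<^sub>R A v - (l * r) *\<^sub>R v" for v
    unfolding trace det by (cases v) (simp add: A_def algebra_simps)
  ultimately interpret diagonalized_operator A "{l, r}" "quadratic_projection A l r"
    using \<open>l < r\<close> by (intro diagonalized_if_quadratic) auto
  show ?thesis
  proof
    assume stable: "locally_asymptotically_stable (\<lambda>x. A (x - p)) p"
    show "a * d - c * b > 0"
    proof (rule ccontr)
      assume "\<not> a * d - c * b > 0"
      then have "l * r < 0"
        using det assms by linarith
      then have "r > 0"
        using \<open>l < r\<close> by (auto simp: mult_less_0_iff)
      \<comment> \<open>The first coordinate of \<open>A (0, 1)\<close> is \<open>c\<close>, so \<open>(0, 1)\<close> is not an eigenvector for \<open>l\<close>.\<close>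
      moreover have "quadratic_projection A l r r (0, 1) \<noteq> 0"
        using \<open>l < r\<close> \<open>c > 0\<close> by (simp add: quadratic_projection_def A_def zero_prod_def)
      ultimately have "\<not> locally_attractive (\<lambda>x. A (x - p)) p"
        by (intro not_attractive_if_positive_eigenvalue) auto
      with stable show False
        by (simp add: locally_asymptotically_stable_def)
    qed
  next
    assume "a * d - c * b > 0"
    then have "l * r > 0" and "l + r < 0"
      using trace det assms by auto
    then have "l < 0" and "r < 0"
      by (auto simp: zero_less_mult_iff)
    then show "locally_asymptotically_stable (\<lambda>x. A (x - p)) p"
      by (intro stable_if_negative_spectrum) auto
  qed
qed

theorem theorem2:
  fixes \<Lambda> \<omega> \<kappa> \<alpha>1 \<alpha>2 \<gamma> \<delta> \<rho> V Us Es :: real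
  assumes "\<Lambda> > 0" and "\<omega> > 0" and "\<kappa> > 0" and "\<alpha>1 > 0" and "\<alpha>2 > 0"
    and "\<gamma> > 0" and "\<delta> > 0" and "\<rho> > 0" and "V \<ge> 0"
    and "(\<alpha>1 - \<rho>) * \<gamma> + (\<alpha>2 + \<delta>) * \<kappa> * V + \<alpha>1 * (\<alpha>2 + \<delta>) \<noteq> 0"
    and "Us = (\<Lambda> * (\<delta> + \<alpha>2) + (\<omega> + \<Lambda>) * \<gamma>) /
              ((\<alpha>1 - \<rho>) * \<gamma> + (\<alpha>2 + \<delta>) * \<kappa> * V + \<alpha>1 * (\<alpha>2 + \<delta>))"
    and "Es = (\<alpha>1 * \<omega> + \<Lambda> * \<rho> + \<kappa> * (\<omega> + \<Lambda>) * V) /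
              ((\<alpha>1 - \<rho>) * \<gamma> + (\<alpha>2 + \<delta>) * \<kappa> * V + \<alpha>1 * (\<alpha>2 + \<delta>))"
  shows "equilibrium (unemployment_field \<Lambda> \<omega> \<kappa> \<alpha>1 \<alpha>2 \<gamma> \<delta> \<rho> V) (Us, Es) \<and>
    (locally_asymptotically_stable (unemployment_field \<Lambda> \<omega> \<kappa> \<alpha>1 \<alpha>2 \<gamma> \<delta> \<rho> V) (Us, Es) \<longleftrightarrow>
      V * \<alpha>2 * \<kappa> + V * \<delta> * \<kappa> + \<alpha>1 * \<alpha>2 + \<alpha>1 * \<delta> + \<alpha>1 * \<gamma> > \<gamma> * \<rho>)"
proof -
  define a b d where "a = \<kappa> * V + \<alpha>1" and "b = \<kappa> * V + \<rho>" and "d = \<alpha>2 + \<gamma> + \<delta>"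
  define D where "D = (\<alpha>1 - \<rho>) * \<gamma> + (\<alpha>2 + \<delta>) * \<kappa> * V + \<alpha>1 * (\<alpha>2 + \<delta>)"
  have "a > 0" and "b > 0" and "d > 0"
    using assms by (simp_all add: a_def b_def d_def add_nonneg_pos)
  have D_det: "a * d - \<gamma> * b = D"
    by (simp add: a_def b_def d_def D_def algebra_simps)
  have "D \<noteq> 0"
    using assms by (simp add: D_def)
  have "D * Us = \<Lambda> * (\<delta> + \<alpha>2) + (\<omega> + \<Lambda>) * \<gamma>"
    and "D * Es = \<alpha>1 * \<omega> + \<Lambda> * \<rho> + \<kappa> * (\<omega> + \<Lambda>) * V"
    using assms by (simp_all add: D_def)
  \<comment> \<open>These are Cramer's formulas for the two equilibrium equations, whose determinant is \<open>D\<close>.\<close>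
  then have "D * (\<Lambda> - a * Us + \<gamma> * Es) = 0" and "D * (\<omega> + b * Us - d * Es) = 0"
    unfolding D_def a_def b_def d_def by algebra+
  then have rest: "\<Lambda> = a * Us - \<gamma> * Es" "\<omega> = d * Es - b * Us"
    using \<open>D \<noteq> 0\<close> by auto
  have field: "unemployment_field \<Lambda> \<omega> \<kappa> \<alpha>1 \<alpha>2 \<gamma> \<delta> \<rho> V =
      (\<lambda>x. (\<lambda>(u, e). (- a * u + \<gamma> * e, b * u - d * e)) (x - (Us, Es)))"
    unfolding unemployment_field_def rest
    by (auto simp: fun_eq_iff a_def b_def d_def algebra_simps)
  have "equilibrium (unemployment_field \<Lambda> \<omega> \<kappa> \<alpha>1 \<alpha>2 \<gamma> \<delta> \<rho> V) (Us, Es)"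
    unfolding field by (simp add: equilibrium_def zero_prod_def)
  moreover have "locally_asymptotically_stable
      (unemployment_field \<Lambda> \<omega> \<kappa> \<alpha>1 \<alpha>2 \<gamma> \<delta> \<rho> V) (Us, Es) \<longleftrightarrow> a * d - \<gamma> * b > 0"
    unfolding field using \<open>a > 0\<close> \<open>b > 0\<close> \<open>d > 0\<close> \<open>\<gamma> > 0\<close> \<open>D \<noteq> 0\<close> D_det
    by (intro planar_cooperative_stable_iff) auto
  moreover have "a * d - \<gamma> * b > 0 \<longleftrightarrow>
      V * \<alpha>2 * \<kappa> + V * \<delta> * \<kappa> + \<alpha>1 * \<alpha>2 + \<alpha>1 * \<delta> + \<alpha>1 * \<gamma> > \<gamma> * \<rho>"
    unfolding D_det D_def by (simp add: algebra_simps)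
  ultimately show ?thesis
    by simp
qed

end
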